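(* Let $V$ be a finite-dimensional, indecomposable calibrated representation of the algebra $A$ (the degenerate affine periplectic Brauer algebra on two strands) on which $e$ does not act by $0$. Then there exist $k,\ell\in\mathbb{N}$, a matrix $S\in M_{k\times\ell}(\mathbb{C})$, and a vector $(\underline{a},\underline{b})\in\mathbb{C}^{k+\ell}$ such that $V$ is, with respect to a suitable basis, the representation $V_{k,\ell}(S;(\underline{a},\underline{b}))$ (i.e. $V\cong V_{k,\ell}(S;(\underline{a},\underline{b}))$).
   Context: $A$ denotes the degenerate affine periplectic Brauer algebra on $2$ strands: the associative unital $\mathbb{C}$-algebra generated by $s,y_1,y_2,e$ with relations $$s^2=1,\quad y_1y_2=y_2y_1,\quad sy_1=y_2s-1-e,\quad sy_2=y_1s+1-e,$$ $$e^2=0,\quad es=e,\quad se=-e,\quad ey_2=ey_1+e,\quad y_1e=y_2e+e.$$ A representation $V$ of $A$ is called calibrated if $V$ has a basis with respect to which the actions of $y_1$ and $y_2$ are both given by diagonal matrices. $\mathbb{N}=\{1,2,\dots\}$. $M_{k\times\ell}(\mathbb{C})$ is the space of $k\times\ell$ complex matrices. A vector in $\mathbb{C}^{k+\ell}$ is written $(\underline{a},\underline{b})=(a_1,\dots,a_k,b_1,\dots,b_\ell)$. For $k,\ell\in\mathbb{N}$, $S\in M_{k\times\ell}(\mathbb{C})$ and $(\underline{a},\underline{b})\in\mathbb{C}^{k+\ell}$, the representation $V_{k,\ell}(S;(\underline{a},\underline{b}))$ of $A$ is the vector space $\mathbb{C}^{k+\ell}$ on which the generators act by the matrices $$y_1=\mathrm{diag}(a_1,\dots,a_k,b_1-1,\dots,b_\ell-1),\quad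 y_2=\mathrm{diag}(a_1-1,\dots,a_k-1,b_1,\dots,b_\ell),$$ $$s=\begin{pmatrix}-\mathrm{Id}_k&S\\0&\mathrm{Id}_\ell\end{pmatrix},\quad e=-sy_2+y_1s+\mathrm{Id}_{k+\ell}.$$ *)

theory Defs
  imports "HOL-Library.Poly_Mapping" "Jordan_Normal_Form.Matrix"
begin

section \<open>The free algebra on four generators\<close>

datatype gen = Gs | Gy1 | Gy2 | Ge

datatype gen_word = Word (letters: "gen list")

instantiation gen_word :: monoid_add
begin

definition zero_gen_word :: gen_word where "0 = Word []"

definition plus_gen_word :: "gen_word \<Rightarrow> gen_word \<Rightarrow> gen_word" where
  "v + w = Word (letters v @ letters w)"

instance by standard (auto simp: zero_gen_word_def plus_gen_word_def)

end

text \<open>Finitely supported functions on the (additively written) free monoid, with the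
  convolution product: the free associative unital complex algebra.\<close>

type_synonym free_alg = "gen_word \<Rightarrow>\<^sub>0 complex"

definition free_gen :: "gen \<Rightarrow> free_alg" where
  "free_gen g = Poly_Mapping.single (Word [g]) 1"

definition free_scale :: "complex \<Rightarrow> free_alg \<Rightarrow> free_alg" where
  "free_scale c f = Poly_Mapping.single 0 c * f"

lemma free_alg_induct [case_names zero single_add]:
  fixes f :: free_alg
  assumes "P 0" and "\<And>w c f. P f \<Longrightarrow> P (Poly_Mapping.single w c + f)"
  shows "P f"
proof (induction f rule: Poly_Mapping.update_induct)
  case const
  show ?case by (rule assms)
next
  case (update f w c)
  have "Poly_Mapping.update w c f = Poly_Mapping.single w c + f"
    using update(1)
    by (intro poly_mapping_eqI) (auto simp: lookup_update lookup_add lookup_single when_def in_keys_iff)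
  with assms(2)[OF update(3)] show ?case by simp
qed

lemma single_zero_commute:
  fixes f :: free_alg
  shows "Poly_Mapping.single 0 c * f = f * Poly_Mapping.single 0 c"
  by (induction f rule: free_alg_induct) (auto simp: mult_single mult.commute algebra_simps)


section \<open>The degenerate affine periplectic Brauer algebra on two strands\<close>

text \<open>A pair \<open>(l, r)\<close> stands for the defining relation \<open>l = r\<close>.\<close>

definition relations :: "(free_alg \<times> free_alg) set" where
  "relations =
    (let s = free_gen Gs; y1 = free_gen Gy1; y2 = free_gen Gy2; e = free_gen Ge in
     {(s * s, 1),
      (y1 * y2, y2 * y1),
      (s * y1, y2 * s - 1 - e),
      (s * y2, y1 * s + 1 - e),
      (e * e, 0),
      (e * s, e),
      (s * e, - e),
      (e * y2, e * y1 + e),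
      (y1 * e, y2 * e + e)})"

inductive_set rel_ideal :: "free_alg set" where
  rel: "(l, r) \<in> relations \<Longrightarrow> l - r \<in> rel_ideal"
| zero: "0 \<in> rel_ideal"
| add: "f \<in> rel_ideal \<Longrightarrow> g \<in> rel_ideal \<Longrightarrow> f + g \<in> rel_ideal"
| mult_left: "f \<in> rel_ideal \<Longrightarrow> g * f \<in> rel_ideal"
| mult_right: "f \<in> rel_ideal \<Longrightarrow> f * g \<in> rel_ideal"

lemma rel_ideal_uminus: "f \<in> rel_ideal \<Longrightarrow> - f \<in> rel_ideal"
  using rel_ideal.mult_left[of f "- 1"] by simp

definition rel_equiv :: "free_alg \<Rightarrow> free_alg \<Rightarrow> bool" where
  "rel_equiv f g \<longleftrightarrow> f - g \<in> rel_ideal"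

quotient_type pbrauer = free_alg / rel_equiv
proof (rule equivpI)
  show "reflp rel_equiv"
    by (auto simp: reflp_def rel_equiv_def rel_ideal.zero)
  show "symp rel_equiv"
    using rel_ideal_uminus by (fastforce simp: symp_def rel_equiv_def)
  show "transp rel_equiv"
  proof (rule transpI)
    fix f g h assume "rel_equiv f g" "rel_equiv g h"
    then have "(f - g) + (g - h) \<in> rel_ideal"
      unfolding rel_equiv_def by (rule rel_ideal.add)
    then show "rel_equiv f h" by (simp add: rel_equiv_def)
  qed
qed

lemma rel_equiv_mult:
  assumes "rel_equiv f f'" "rel_equiv g g'"
  shows "rel_equiv (f * g) (f' * g')"
proof -
  have "(f - f') * g + f' * (g - g') \<in> rel_ideal"
    using assms unfolding rel_equiv_def
    by (intro rel_ideal.add rel_ideal.mult_left rel_ideal.mult_right)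
  then show ?thesis by (simp add: rel_equiv_def algebra_simps)
qed

lemma rel_equiv_add:
  assumes "rel_equiv f f'" "rel_equiv g g'"
  shows "rel_equiv (f + g) (f' + g')"
  using rel_ideal.add[of "f - f'" "g - g'"] assms
  by (simp add: rel_equiv_def algebra_simps)

lemma rel_equiv_uminus: "rel_equiv f f' \<Longrightarrow> rel_equiv (- f) (- f')"
  using rel_ideal_uminus[of "f - f'"] by (simp add: rel_equiv_def)

instantiation pbrauer :: ring
begin

lift_definition zero_pbrauer :: pbrauer is 0 .
lift_definition plus_pbrauer :: "pbrauer \<Rightarrow> pbrauer \<Rightarrow> pbrauer" is "(+)"
  by (rule rel_equiv_add)
lift_definition uminus_pbrauer :: "pbrauer \<Rightarrow> pbrauer" is uminus
  by (rule rel_equiv_uminus)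
lift_definition minus_pbrauer :: "pbrauer \<Rightarrow> pbrauer \<Rightarrow> pbrauer" is "(-)"
  using rel_equiv_add[OF _ rel_equiv_uminus] by fastforce
lift_definition times_pbrauer :: "pbrauer \<Rightarrow> pbrauer \<Rightarrow> pbrauer" is "(*)"
  by (rule rel_equiv_mult)

instance
  by standard (transfer, simp add: rel_equiv_def algebra_simps rel_ideal.zero)+

end

text \<open>Only \<open>monoid_mult\<close> and not \<open>ring_1\<close>, so that \<open>0 \<noteq> 1\<close> need not be proved.\<close>

instantiation pbrauer :: monoid_mult
begin

lift_definition one_pbrauer :: pbrauer is 1 .

instance
  by standard (transfer, simp add: rel_equiv_def rel_ideal.zero)+

end

lift_definition pb_scale :: "complex \<Rightarrow> pbrauer \<Rightarrow> pbrauer" is free_scale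
  unfolding free_scale_def by (rule rel_equiv_mult) (simp_all add: rel_equiv_def rel_ideal.zero)

lift_definition pb_gen :: "gen \<Rightarrow> pbrauer" is free_gen .

lemma pb_scale_mult_left: "pb_scale c (x * y) = pb_scale c x * y"
  by transfer (simp add: free_scale_def rel_equiv_def mult.assoc rel_ideal.zero)

lemma pb_scale_mult_right: "pb_scale c (x * y) = x * pb_scale c y"
proof transfer
  fix c and x y :: free_alg
  have "free_scale c (x * y) = x * free_scale c y"
    unfolding free_scale_def by (metis mult.assoc single_zero_commute)
  then show "rel_equiv (free_scale c (x * y)) (x * free_scale c y)"
    by (simp add: rel_equiv_def rel_ideal.zero)
qed

lemma vector_space_pbrauer: "vector_space pb_scale"
proof
  fix a b :: complex and x y :: pbrauer
  show "pb_scale a (x + y) = pb_scale a x + pb_scale a y"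
    by transfer (simp add: free_scale_def rel_equiv_def rel_ideal.zero algebra_simps)
  show "pb_scale (a + b) x = pb_scale a x + pb_scale b x"
    by transfer (simp add: free_scale_def rel_equiv_def rel_ideal.zero single_add algebra_simps)
  show "pb_scale a (pb_scale b x) = pb_scale (a * b) x"
    by transfer (simp add: free_scale_def rel_equiv_def rel_ideal.zero mult_single
        flip: mult.assoc)
  show "pb_scale 1 x = x"
    by transfer (simp add: free_scale_def rel_equiv_def rel_ideal.zero)
qed

lemma pbrauer_relations:
  defines "s \<equiv> pb_gen Gs" and "y1 \<equiv> pb_gen Gy1" and "y2 \<equiv> pb_gen Gy2" and "e \<equiv> pb_gen Ge"
  shows "s * s = 1" "y1 * y2 = y2 * y1"
    "s * y1 = y2 * s - 1 - e" "s * y2 = y1 * s + 1 - e"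
    "e * e = 0" "e * s = e" "s * e = - e"
    "e * y2 = e * y1 + e" "y1 * e = y2 * e + e"
  unfolding assms
  by (transfer, unfold rel_equiv_def, rule rel_ideal.rel, simp add: relations_def Let_def)+


section \<open>Representations\<close>

locale pbrauer_rep = vector_space scale
  for scale :: "complex \<Rightarrow> 'v::ab_group_add \<Rightarrow> 'v" (infixr "*s" 75) +
  fixes \<rho> :: "pbrauer \<Rightarrow> 'v \<Rightarrow> 'v"
  assumes rho_linear: "Vector_Spaces.linear scale scale (\<rho> x)"
    and rho_one: "\<rho> 1 v = v"
    and rho_mult: "\<rho> (x * y) v = \<rho> x (\<rho> y v)"
    and rho_add: "\<rho> (x + y) v = \<rho> x v + \<rho> y v"
    and rho_scale: "\<rho> (pb_scale c x) v = c *s \<rho> x v"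
begin

definition finite_dim :: bool where
  "finite_dim \<longleftrightarrow> (\<exists>B. finite B \<and> span B = UNIV)"

definition subrep :: "'v set \<Rightarrow> bool" where
  "subrep U \<longleftrightarrow> subspace U \<and> (\<forall>x. \<forall>u\<in>U. \<rho> x u \<in> U)"

definition indecomposable :: bool where
  "indecomposable \<longleftrightarrow> (\<exists>v::'v. v \<noteq> 0) \<and>
    (\<forall>U W. subrep U \<and> subrep W \<and> U \<inter> W = {0} \<and> (\<forall>v. \<exists>u\<in>U. \<exists>w\<in>W. v = u + w)
      \<longrightarrow> U = {0} \<or> W = {0})"

definition ordered_basis :: "'v list \<Rightarrow> bool" where
  "ordered_basis bs \<longleftrightarrow> distinct bs \<and> independent (set bs) \<and> span (set bs) = UNIV"

text \<open>Columns of \<open>M\<close> are the coordinates of the images of the basis vectors.\<close>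

definition has_matrix :: "'v list \<Rightarrow> ('v \<Rightarrow> 'v) \<Rightarrow> complex mat \<Rightarrow> bool" where
  "has_matrix bs T M \<longleftrightarrow> M \<in> carrier_mat (length bs) (length bs) \<and>
    (\<forall>j<length bs. T (bs ! j) = (\<Sum>i<length bs. M $$ (i, j) *s (bs ! i)))"

text \<open>Ordered bases are finite, so this is meant for finite-dimensional representations.\<close>

definition calibrated :: bool where
  "calibrated \<longleftrightarrow> (\<exists>bs D1 D2. ordered_basis bs \<and> diagonal_mat D1 \<and> diagonal_mat D2 \<and>
    has_matrix bs (\<rho> (pb_gen Gy1)) D1 \<and> has_matrix bs (\<rho> (pb_gen Gy2)) D2)"

end


section \<open>The representations \<open>V\<^sub>k\<^sub>,\<^sub>l(S; (a, b))\<close>\<close>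

definition V_y1 :: "nat \<Rightarrow> nat \<Rightarrow> complex vec \<Rightarrow> complex vec \<Rightarrow> complex mat" where
  "V_y1 k l a b = mat_diag (k + l) (\<lambda>i. if i < k then a $ i else b $ (i - k) - 1)"

definition V_y2 :: "nat \<Rightarrow> nat \<Rightarrow> complex vec \<Rightarrow> complex vec \<Rightarrow> complex mat" where
  "V_y2 k l a b = mat_diag (k + l) (\<lambda>i. if i < k then a $ i - 1 else b $ (i - k))"

definition V_s :: "nat \<Rightarrow> nat \<Rightarrow> complex mat \<Rightarrow> complex mat" where
  "V_s k l S = four_block_mat (- 1\<^sub>m k) S (0\<^sub>m l k) (1\<^sub>m l)"

fun V_mat :: "nat \<Rightarrow> nat \<Rightarrow> complex mat \<Rightarrow> complex vec \<Rightarrow> complex vec \<Rightarrow> gen \<Rightarrow> complex mat" where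
  "V_mat k l S a b Gs = V_s k l S"
| "V_mat k l S a b Gy1 = V_y1 k l a b"
| "V_mat k l S a b Gy2 = V_y2 k l a b"
| "V_mat k l S a b Ge = - (V_s k l S * V_y2 k l a b) + V_y1 k l a b * V_s k l S + 1\<^sub>m (k + l)"

text \<open>For arbitrary \<open>S\<close>, \<open>a\<close>, \<open>b\<close> the matrices need not satisfy the defining relations;
  when the generators of a representation act by them in some basis, they do.\<close>

definition (in pbrauer_rep) iso_to_V ::
    "nat \<Rightarrow> nat \<Rightarrow> complex mat \<Rightarrow> complex vec \<Rightarrow> complex vec \<Rightarrow> bool" where
  "iso_to_V k l S a b \<longleftrightarrow> (\<exists>bs. ordered_basis bs \<and> length bs = k + l \<and>
    (\<forall>g. has_matrix bs (\<rho> (pb_gen g)) (V_mat k l S a b g)))"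

end

theory Submission
  imports Defs
begin

text \<open>
  Put \<open>D = y\<^sub>1 - y\<^sub>2\<close>. The relations give \<open>s D + D s = -2\<close>, so \<open>F = D\<^sup>2 - 1\<close> commutes with \<open>s\<close>
  as well as with \<open>y\<^sub>1\<close> and \<open>y\<^sub>2\<close>, and \<open>e F = 0\<close>. Since \<open>D\<close> is diagonalizable, \<open>V\<close> is the direct sum
  of \<open>P = ker (D - 1)\<close>, \<open>Q = ker (D + 1)\<close> and the image of \<open>F\<close>. The map \<open>s + 1\<close> sends \<open>P\<close> to \<open>Q\<close>,
  the map \<open>s - 1\<close> sends \<open>Q\<close> to \<open>P\<close>, and \<open>s\<^sup>2 = 1\<close> forces both composites to vanish. With
  \<open>K = ker (s + 1) \<inter> P\<close> and \<open>L = (s + 1) P\<close>, choose complements \<open>P = K \<oplus> P'\<close> and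
  \<open>Q = L \<oplus> Q'\<close> spanned by weight vectors. Then \<open>P' \<oplus> L \<oplus> im F\<close> and \<open>K \<oplus> Q'\<close> are
  complementary subrepresentations, and \<open>e\<close> kills the first. By indecomposability the first is
  zero: \<open>V = P \<oplus> Q\<close> and \<open>s = -1\<close> on \<open>P\<close>, which is the required block form.
\<close>

section \<open>Diagonal operators and complements\<close>

context vector_space
begin

text \<open>Coefficients with respect to \<open>X\<close> and to \<open>Y\<close> both agree with
  those with respect to \<open>B\<close>, so their support lies in
  \<open>X \<inter> Y\<close>.\<close>

lemma span_Int_disjoint_subsets:
  assumes "independent B" "X \<subseteq> B" "Y \<subseteq> B" "X \<inter> Y = {}"
  shows "span X \<inter> span Y = {0}"
proof -
  have "v = 0" if "v \<in> span X" "v \<in> span Y" for v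
  proof -
    have "representation X v = representation Y v"
      using representation_extend[OF assms(1) that(1) assms(2)]
        representation_extend[OF assms(1) that(2) assms(3)] by simp
    then have "representation X v b = 0" for b
      using assms(4) representation_ne_zero[of X v b] representation_ne_zero[of Y v b] by auto
    moreover have "independent X"
      using assms independent_mono by blast
    ultimately show "v = 0"
      using sum_nonzero_representation_eq[of X v] that by simp
  qed
  then show ?thesis
    using span_zero by auto
qed

text \<open>Steinitz exchange: a basis of \<open>K\<close> is extended by members of
  \<open>B\<close>. When \<open>B\<close> consists of weight vectors, the resulting complement is
  stable under \<open>y1\<close> and \<open>y2\<close>, which an arbitrary complement need not
  be.\<close>

lemma exists_complement_spanned_by_subset:
  assumes "subspace K"
  shows "\<exists>C\<subseteq>B. K \<inter> span C = {0} \<and> (\<forall>v\<in>span B. \<exists>x\<in>K. \<exists>y\<in>span C. v = x + y)"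
proof -
  obtain A where A: "A \<subseteq> K" "independent A" "K \<subseteq> span A"
    using maximal_independent_subset by blast
  then have K: "K = span A"
    using span_minimal[OF A(1) assms] by blast
  obtain X where X: "A \<subseteq> X" "X \<subseteq> A \<union> B" "independent X" "A \<union> B \<subseteq> span X"
    using maximal_independent_subset_extend[of A "A \<union> B"] A(2) by blast
  have "span B \<subseteq> span (A \<union> (X - A))"
    using X(1,4) span_minimal[of B "span X"] by (simp add: Un_absorb1)
  then have "v \<in> {x + y |x y. x \<in> K \<and> y \<in> span (X - A)}" if "v \<in> span B" for v
    using that by (auto simp only: span_Un K[symmetric])
  moreover have "K \<inter> span (X - A) = {0}"
    unfolding K using X by (intro span_Int_disjoint_subsets[of X]) auto
  moreover have "X - A \<subseteq> B"
    using X(2) by blast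
  ultimately show ?thesis
    by (intro exI[of _ "X - A"]) blast
qed

context
  fixes B f c
  assumes indep: "independent B"
    and lin: "Vector_Spaces.linear scale scale f"
    and diag: "\<And>b. b \<in> B \<Longrightarrow> f b = c b *s b"
begin

interpretation f: Vector_Spaces.linear scale scale f
  by (fact lin)

lemma diagonal_decompose:
  assumes "v \<in> span B"
  obtains x y where "v = x + y" "x \<in> span {b\<in>B. c b = 0}" "y \<in> span {b\<in>B. c b \<noteq> 0}"
proof -
  have B: "{b\<in>B. c b = 0} \<union> {b\<in>B. c b \<noteq> 0} = B"
    by auto
  then show ?thesis
    using that assms span_Un[of "{b\<in>B. c b = 0}" "{b\<in>B. c b \<noteq> 0}", unfolded B] by blast
qed

lemma diagonal_span_zero_eigenvectors:
  assumes "x \<in> span {b\<in>B. c b = 0}"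
  shows "f x = 0"
  using assms by (induction rule: span_induct_alt) (auto simp: f.add f.scale diag f.zero)

text \<open>Applying \<open>f\<close> multiplies the coefficient at \<open>b\<close> by
  \<open>c b\<close>, which is nonzero here, so independence forces every coefficient of
  \<open>y\<close> to vanish.\<close>

lemma diagonal_inj_on_nonzero_eigenvectors:
  assumes "y \<in> span {b\<in>B. c b \<noteq> 0}" and "f y = 0"
  shows "y = 0"
proof -
  let ?N = "{b\<in>B. c b \<noteq> 0}"
  let ?r = "representation ?N y"
  let ?T = "{b. ?r b \<noteq> 0}"
  have N: "independent ?N"
    using indep by (rule independent_mono) blast
  have y: "(\<Sum>b\<in>?T. ?r b *s b) = y"
    using sum_nonzero_representation_eq[OF N assms(1)] .
  have T: "?T \<subseteq> ?N"
    using representation_ne_zero by blast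
  have "0 = f (\<Sum>b\<in>?T. ?r b *s b)"
    unfolding y assms(2) ..
  also have "\<dots> = (\<Sum>b\<in>?T. (?r b * c b) *s b)"
    unfolding f.sum using T by (intro sum.cong) (auto simp: f.scale diag)
  finally have "?r b * c b = 0" if "b \<in> ?T" for b
    using that independentD[OF N finite_representation T, of "\<lambda>b. ?r b * c b"] by simp
  then have "?T = {}"
    using T by fastforce
  then show ?thesis
    using y by simp
qed

lemma diagonal_kernel:
  assumes "v \<in> span B" and "f v = 0"
  shows "v \<in> span {b\<in>B. c b = 0}"
proof -
  obtain x y where xy: "v = x + y" "x \<in> span {b\<in>B. c b = 0}" "y \<in> span {b\<in>B. c b \<noteq> 0}"
    by (rule diagonal_decompose[OF assms(1)])
  then have "f y = 0"
    using assms(2) diagonal_span_zero_eigenvectors by (simp add: f.add)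
  then have "y = 0"
    using xy(3) diagonal_inj_on_nonzero_eigenvectors by blast
  then show ?thesis
    using xy by simp
qed

lemma diagonal_range_subset:
  assumes "v \<in> span B"
  shows "f v \<in> span {b\<in>B. c b \<noteq> 0}"
  using assms
proof (induction rule: span_induct_alt)
  case (step a b w)
  have "f b \<in> span {b\<in>B. c b \<noteq> 0}"
    using step(1) by (cases "c b = 0") (auto simp: diag span_zero intro: span_scale span_base)
  then show ?case
    using step(2) by (simp add: f.add f.scale span_add span_scale)
qed (simp add: f.zero span_zero)

text \<open>Diagonalizability excludes a nilpotent part: \<open>f v\<close> lies in the span of the
  eigenvectors with nonzero eigenvalue, where \<open>f\<close> is injective.\<close>

lemma diagonal_kernel_Int_range:
  assumes "v \<in> span B" and "f (f v) = 0"
  shows "f v = 0"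
  using assms diagonal_range_subset diagonal_inj_on_nonzero_eigenvectors by blast

lemma diagonal_kernel_plus_range:
  assumes "v \<in> span B"
  obtains x w where "v = x + f w" "f x = 0"
proof -
  obtain x y where xy: "v = x + y" "x \<in> span {b\<in>B. c b = 0}" "y \<in> span {b\<in>B. c b \<noteq> 0}"
    by (rule diagonal_decompose[OF assms])
  have "{b\<in>B. c b \<noteq> 0} \<subseteq> range f"
  proof clarify
    fix b assume "b \<in> B" "c b \<noteq> 0"
    then have "b = f (inverse (c b) *s b)"
      by (simp add: f.scale diag)
    then show "b \<in> range f" by blast
  qed
  then have "y \<in> range f"
    using xy(3) span_minimal[of _ "range f"] f.subspace_image[OF subspace_UNIV] by blast
  then show ?thesis
    using that xy diagonal_span_zero_eigenvectors by blast
qed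

end

end

section \<open>Coordinates along lists\<close>

lemma sum_lessThan_add:
  fixes g :: "nat \<Rightarrow> 'a::comm_monoid_add"
  shows "(\<Sum>i<m + n. g i) = (\<Sum>i<m. g i) + (\<Sum>i<n. g (m + i))"
  by (induction n) (simp_all add: add.assoc)

lemma (in vector_space) span_set_nth:
  assumes "distinct xs" "v \<in> span (set xs)"
  shows "\<exists>c. v = (\<Sum>i<length xs. c i *s xs ! i)"
proof -
  obtain u where "v = (\<Sum>x\<in>set xs. u x *s x)"
    using assms(2) span_finite[of "set xs"] by auto
  also have "\<dots> = (\<Sum>i<length xs. u (xs ! i) *s xs ! i)"
    using sum.reindex_bij_betw[OF bij_betw_nth[OF assms(1) refl refl], of "\<lambda>x. u x *s x"] by simp
  finally show ?thesis
    by (intro exI[of _ "\<lambda>i. u (xs ! i)"])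
qed

section \<open>The splitting of a calibrated representation\<close>

text \<open>Words span the free algebra and hence its quotient, and each word arises from 1 by left
  multiplication with generators. This reduces stability under the whole algebra to stability under
  the generators.\<close>

lemma pbrauer_induct [case_names one add scale gen_mult]:
  assumes "P 1"
    and "\<And>x y. P x \<Longrightarrow> P y \<Longrightarrow> P (x + y)"
    and "\<And>c x. P x \<Longrightarrow> P (pb_scale c x)"
    and "\<And>g x. P x \<Longrightarrow> P (pb_gen g * x)"
  shows "P x"
proof -
  have word: "P (abs_pbrauer (Poly_Mapping.single (Word l) 1))" for l
  proof (induction l)
    case Nil
    have "Poly_Mapping.single (Word []) (1::complex) = 1"
      by (simp flip: zero_gen_word_def)
    then show ?case
      using assms(1) by (simp add: one_pbrauer_def)
  next
    case (Cons g l)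
    have "Poly_Mapping.single (Word (g # l)) (1::complex)
        = free_gen g * Poly_Mapping.single (Word l) 1"
      by (simp add: free_gen_def mult_single plus_gen_word_def)
    then show ?case
      using assms(4)[OF Cons, of g] by (simp add: pb_gen_def times_pbrauer.abs_eq)
  qed
  have "P (abs_pbrauer f)" for f
  proof (induction f rule: free_alg_induct)
    case zero
    \<comment> \<open>The induction rule has no case for zero; it is reached as a scalar multiple of
      1.\<close>
    have "pb_scale 0 1 = 0"
      by (rule module.scale_zero_left)
        (use vector_space_pbrauer in \<open>simp add: module_iff_vector_space\<close>)
    then show ?case
      using assms(3)[OF assms(1), of 0] by (simp add: zero_pbrauer_def)
  next
    case (single_add w c f)
    have "Poly_Mapping.single w c = free_scale c (Poly_Mapping.single (Word (letters w)) 1)"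
      by (simp add: free_scale_def mult_single)
    then have "P (abs_pbrauer (Poly_Mapping.single w c))"
      using assms(3)[OF word[of "letters w"], of c] by (simp add: pb_scale.abs_eq)
    then show ?case
      using assms(2) single_add by (simp flip: plus_pbrauer.abs_eq)
  qed
  then show ?thesis
    by (cases x) (metis Quotient_abs_rep[OF Quotient_pbrauer])
qed

section \<open>The defining relations as operator identities\<close>

context pbrauer_rep
begin

interpretation rho: Vector_Spaces.linear scale scale "\<rho> x" for x
  by (rule rho_linear)

lemma rho_zero: "\<rho> 0 v = 0"
  using rho_add[of 0 0 v] by simp

lemma rho_uminus: "\<rho> (- x) v = - \<rho> x v"
  using rho_add[of "- x" x v] by (simp add: rho_zero eq_neg_iff_add_eq_0)

lemma rho_diff: "\<rho> (x - y) v = \<rho> x v - \<rho> y v"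
  using rho_add[of x "- y" v] by (simp add: rho_uminus)

abbreviation "s \<equiv> \<rho> (pb_gen Gs)"
abbreviation "y1 \<equiv> \<rho> (pb_gen Gy1)"
abbreviation "y2 \<equiv> \<rho> (pb_gen Gy2)"
abbreviation "e \<equiv> \<rho> (pb_gen Ge)"

lemma s_s: "s (s v) = v"
  using arg_cong[OF pbrauer_relations(1), of "\<lambda>x. \<rho> x v"] by (simp add: rho_mult rho_one)

lemma y1_y2: "y1 (y2 v) = y2 (y1 v)"
  using arg_cong[OF pbrauer_relations(2), of "\<lambda>x. \<rho> x v"] by (simp add: rho_mult)

lemma y2_s: "y2 (s v) = s (y1 v) + v + e v"
  using arg_cong[OF pbrauer_relations(3), of "\<lambda>x. \<rho> x v"]
  by (simp add: rho_mult rho_diff rho_one)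

lemma y1_s: "y1 (s v) = s (y2 v) - v + e v"
  using arg_cong[OF pbrauer_relations(4), of "\<lambda>x. \<rho> x v"]
  by (simp add: rho_mult rho_diff rho_add rho_one)

lemma e_s: "e (s v) = e v"
  using arg_cong[OF pbrauer_relations(6), of "\<lambda>x. \<rho> x v"] by (simp add: rho_mult)

lemma e_y2: "e (y2 v) = e (y1 v) + e v"
  using arg_cong[OF pbrauer_relations(8), of "\<lambda>x. \<rho> x v"] by (simp add: rho_mult rho_add)

lemma y1_e: "y1 (e v) = y2 (e v) + e v"
  using arg_cong[OF pbrauer_relations(9), of "\<lambda>x. \<rho> x v"] by (simp add: rho_mult rho_add)

text \<open>This is the formula by which \<open>V_mat\<close> defines the matrix of
  \<open>e\<close>; it transfers both stability and matrices from the other three generators to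
  \<open>e\<close>.\<close>

lemma e_eq: "e v = - s (y2 v) + y1 (s v) + v"
  by (simp add: y1_s)

lemma eq_zero_if_double:
  fixes v :: 'v
  shows "v + v = 0 \<Longrightarrow> v = 0"
  using scale_left_distrib[of 1 1 v] scale_eq_0_iff[of 2 v] by simp

section \<open>The eigenspaces of \<open>D\<close> and the operator \<open>F\<close>\<close>

definition "P = {v. y1 v = y2 v + v}"
definition "Q = {v. y2 v = y1 v + v}"
definition "D v = y1 v - y2 v"
definition "F v = D (D v) - v"


lemma P_iff_D: "v \<in> P \<longleftrightarrow> D v = v"
  unfolding P_def D_def mem_Collect_eq diff_eq_eq by (simp only: add.commute)

lemma Q_iff_D: "v \<in> Q \<longleftrightarrow> D v = - v"
proof -
  have "v \<in> Q \<longleftrightarrow> - (y2 v - y1 v) = - v"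
    unfolding Q_def mem_Collect_eq neg_equal_iff_equal diff_eq_eq by (simp only: add.commute)
  then show ?thesis
    by (simp add: D_def)
qed

lemma subspace_P: "subspace P"
  by (auto simp: subspace_def P_def rho.zero rho.add rho.scale algebra_simps)

lemma subspace_Q: "subspace Q"
  by (auto simp: subspace_def Q_def rho.zero rho.add rho.scale algebra_simps)

lemma P_Int_Q:
  assumes "v \<in> P" "v \<in> Q"
  shows "v = 0"
proof (rule eq_zero_if_double)
  have "y1 v = y1 v + v + v"
    using assms by (simp add: P_def Q_def)
  then show "v + v = 0"
    by (simp add: add.assoc)
qed

lemma y1_P: "p \<in> P \<Longrightarrow> y1 p \<in> P"
  by (simp add: P_def rho.add y1_y2)

lemma y2_P: "p \<in> P \<Longrightarrow> y2 p \<in> P"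
  by (simp add: P_def rho.add y1_y2)

text \<open>Substituting y1 p = y2 p + p into e y2 = e y1 + e leaves 2 e p = 0.\<close>

lemma e_P:
  assumes "p \<in> P"
  shows "e p = 0"
proof (rule eq_zero_if_double)
  have "e (y2 p) = e (y2 p) + e p + e p"
    using e_y2[of p] assms by (simp add: P_def rho.add)
  then show "e p + e p = 0"
    by (simp add: add.assoc)
qed

lemma e_in_P: "e v \<in> P"
  by (simp add: P_def y1_e)

text \<open>From s D + D s = -2 and D p = p one gets D (s p + p) = -(s p + p). The next lemma is the
  same computation with signs reversed.\<close>

lemma s_P_in_Q:
  assumes "p \<in> P"
  shows "s p + p \<in> Q"
  using assms e_P[OF assms] by (simp add: P_def Q_def rho.add y1_s y2_s)

lemma s_Q_in_P:
  assumes "q \<in> Q"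
  shows "s q - q \<in> P"
  using assms by (simp add: P_def Q_def rho.add rho.diff y1_s y2_s)

text \<open>On \<open>P\<close> the map s + 1 interchanges \<open>y1\<close> and \<open>y2\<close>;
  this and the next lemma make its kernel \<open>K\<close> and image \<open>L\<close> stable under
  both.\<close>

lemma y1_s_P:
  assumes "p \<in> P"
  shows "y1 (s p + p) = s (y2 p) + y2 p"
  using assms e_P[OF assms] by (simp add: P_def rho.add y1_s)

lemma y2_s_P:
  assumes "p \<in> P"
  shows "y2 (s p + p) = s (y1 p) + y1 p"
  using assms e_P[OF assms] by (simp add: P_def rho.add y2_s)

text \<open>The terms in \<open>e\<close> coming from y1 s and y2 s cancel in the
  difference.\<close>

lemma D_s: "D (s v) = - s (D v) - v - v"
  by (simp add: D_def y1_s y2_s rho.diff)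

text \<open>Using \<open>D_s\<close> twice, D^2 s = - D s D - 2 D = s D^2 + 2 D - 2 D.\<close>

lemma F_s: "F (s v) = s (F v)"
  by (simp add: F_def D_s) (simp add: D_def rho.diff rho.add rho.neg y1_s y2_s)

lemma F_y1: "F (y1 v) = y1 (F v)"
  by (simp add: F_def D_def rho.diff y1_y2)

lemma F_y2: "F (y2 v) = y2 (F v)"
  by (simp add: F_def D_def rho.diff y1_y2)

text \<open>The relation e y2 = e y1 + e says e D = - e, whence e D^2 = e.\<close>

lemma e_F: "e (F v) = 0"
  by (simp add: F_def D_def rho.diff e_y2)

lemma linear_D: "Vector_Spaces.linear scale scale D"
  by unfold_locales (simp_all add: D_def rho.add rho.scale algebra_simps)

interpretation D: Vector_Spaces.linear scale scale D
  by (rule linear_D)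

lemma linear_F: "Vector_Spaces.linear scale scale F"
  by unfold_locales (simp_all add: F_def D.add D.scale algebra_simps)

interpretation F: Vector_Spaces.linear scale scale F
  by (rule linear_F)

lemma F_P: "p \<in> P \<Longrightarrow> F p = 0"
  by (simp add: P_iff_D F_def)

lemma F_Q: "q \<in> Q \<Longrightarrow> F q = 0"
  by (simp add: Q_iff_D F_def D.neg)

text \<open>Where D^2 = 1, the operators (1 + D)/2 and (1 - D)/2 project onto the eigenspaces for 1
  and -1.\<close>

lemma F_kernel:
  assumes "F v = 0"
  obtains p q where "v = p + q" "p \<in> P" "q \<in> Q"
proof
  have DD: "D (D v) = v"
    using assms by (simp add: F_def)
  have "D (v + D v) = v + D v" "D (v - D v) = - (v - D v)"
    by (simp_all add: D.add D.diff DD)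
  then have "v + D v \<in> P" "v - D v \<in> Q"
    by (simp_all add: P_iff_D Q_iff_D)
  then show "(1/2) *s (v + D v) \<in> P" "(1/2) *s (v - D v) \<in> Q"
    using subspace_P subspace_Q subspace_scale by blast+
  have "v = (1/2 + 1/2) *s v" by simp
  also have "\<dots> = (1/2) *s (v + D v) + (1/2) *s (v - D v)"
    unfolding scale_left_distrib by (simp add: scale_right_distrib scale_right_diff_distrib)
  finally show "v = (1/2) *s (v + D v) + (1/2) *s (v - D v)" .
qed

text \<open>Linearity passes from \<open>X\<close> to its span, \<open>e_eq\<close> supplies the
  missing generator, and \<open>pbrauer_induct\<close> passes to the whole algebra.\<close>

lemma subrep_spanI:
  assumes "\<And>x. x \<in> X \<Longrightarrow> s x \<in> span X" "\<And>x. x \<in> X \<Longrightarrow> y1 x \<in> span X"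
    "\<And>x. x \<in> X \<Longrightarrow> y2 x \<in> span X"
  shows "subrep (span X)"
proof -
  have ext: "\<rho> z u \<in> span X" if "\<And>x. x \<in> X \<Longrightarrow> \<rho> z x \<in> span X" "u \<in> span X" for z u
    using that(2)
    by (induction rule: span_induct_alt)
      (simp_all add: rho.add rho.scale rho.zero that(1) span_add span_scale span_zero)
  have s: "s u \<in> span X" and y1: "y1 u \<in> span X" and y2: "y2 u \<in> span X" if "u \<in> span X" for u
    using ext assms that by blast+
  have e: "e u \<in> span X" if "u \<in> span X" for u
    unfolding e_eq using that by (intro span_add span_neg s y1 y2)
  have gen: "\<rho> (pb_gen g) u \<in> span X" if "u \<in> span X" for g u
    using s y1 y2 e that by (cases g) auto
  have "\<rho> z u \<in> span X" if "u \<in> span X" for z u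
    using that
    by (induction z arbitrary: u rule: pbrauer_induct)
      (auto simp: rho_one rho_add rho_scale rho_mult gen intro: span_add span_scale)
  then show ?thesis
    by (simp add: subrep_def subspace_span)
qed

section \<open>Kernel and image of s + 1 on \<open>P\<close>\<close>

definition "K = {p \<in> P. s p = - p}"
definition "L = (\<lambda>p. s p + p) ` P"

lemma subspace_K: "subspace K"
  using subspace_P
  by (auto simp: K_def subspace_def rho.zero rho.add rho.scale)

lemma subspace_L: "subspace L"
proof -
  have "Vector_Spaces.linear scale scale (\<lambda>p. s p + p)"
    by unfold_locales (simp_all add: rho.add rho.scale algebra_simps)
  then interpret T: Vector_Spaces.linear scale scale "\<lambda>p. s p + p" .
  show ?thesis
    unfolding L_def using subspace_P by (rule T.subspace_image)
qed

lemma L_subset_Q: "L \<subseteq> Q"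
  by (auto simp: L_def s_P_in_Q)

lemma y_K:
  assumes "k \<in> K"
  shows "y1 k \<in> K" "y2 k \<in> K"
proof -
  have "k \<in> P" and k: "s k + k = 0"
    using assms by (auto simp: K_def)
  then have "s (y1 k) + y1 k = 0" "s (y2 k) + y2 k = 0"
    using y1_s_P[of k] y2_s_P[of k] by (auto simp: rho.zero)
  then show "y1 k \<in> K" "y2 k \<in> K"
    using \<open>k \<in> P\<close> by (auto simp: K_def y1_P y2_P eq_neg_iff_add_eq_0)
qed

lemma y_L:
  assumes "l \<in> L"
  shows "y1 l \<in> L" "y2 l \<in> L"
  using assms by (auto simp: L_def y1_s_P y2_s_P y1_P y2_P)

lemma s_L: "l \<in> L \<Longrightarrow> s l = l"
  by (auto simp: L_def rho.add s_s add.commute)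

text \<open>Here (s + 1)(s - 1) = s^2 - 1 = 0 enters.\<close>

lemma s_Q_in_K:
  assumes "q \<in> Q"
  shows "s q - q \<in> K"
  using s_Q_in_P[OF assms] by (simp add: K_def rho.diff s_s)

lemma e_L: "l \<in> L \<Longrightarrow> e l = 0"
  by (auto simp: L_def rho.add e_s e_P)

section \<open>Splitting along a basis of weight vectors\<close>

definition "weight_basis B \<longleftrightarrow> independent B \<and> span B = UNIV \<and>
  (\<forall>b\<in>B. (\<exists>c. y1 b = c *s b) \<and> (\<exists>c. y2 b = c *s b))"

context
  fixes B
  assumes wb: "weight_basis B"
begin

lemma indep_B: "independent B" and span_B: "span B = UNIV"
  using wb by (auto simp: weight_basis_def)

lemma weight_basis_D: "\<exists>c. \<forall>b\<in>B. D b = c b *s b"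
proof -
  have "\<exists>c. D b = c *s b" if b: "b \<in> B" for b
  proof -
    obtain c1 c2 where "y1 b = c1 *s b" "y2 b = c2 *s b"
      using wb b unfolding weight_basis_def by blast
    then have "D b = (c1 - c2) *s b"
      by (simp add: D_def scale_left_diff_distrib)
    then show ?thesis ..
  qed
  then show ?thesis by metis
qed

text \<open>The operator D - r is diagonal on \<open>B\<close>, so \<open>diagonal_kernel\<close>
  describes its kernel.\<close>

lemma D_eigenspace_spanned:
  assumes "D v = r *s v"
  shows "v \<in> span {b\<in>B. D b = r *s b}"
proof -
  obtain c where c: "\<And>b. b \<in> B \<Longrightarrow> D b = c b *s b"
    using weight_basis_D by blast
  have lin: "Vector_Spaces.linear scale scale (\<lambda>v. D v - r *s v)"
    by unfold_locales (simp_all add: D.add D.scale algebra_simps)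
  have "v \<in> span {b\<in>B. c b - r = 0}"
    using assms span_B
    by (intro diagonal_kernel[OF indep_B lin]) (simp_all add: c scale_left_diff_distrib)
  moreover have "{b\<in>B. c b - r = 0} \<subseteq> {b\<in>B. D b = r *s b}"
    by (auto simp: c)
  ultimately show ?thesis
    using span_mono by blast
qed

lemma P_spanned: "P = span (B \<inter> P)"
proof
  show "P \<subseteq> span (B \<inter> P)"
  proof
    fix v assume "v \<in> P"
    then have "v \<in> span {b\<in>B. D b = 1 *s b}"
      by (intro D_eigenspace_spanned) (simp add: P_iff_D)
    moreover have "{b\<in>B. D b = 1 *s b} = B \<inter> P"
      by (auto simp: P_iff_D)
    ultimately show "v \<in> span (B \<inter> P)" by simp
  qed
qed (simp add: span_minimal subspace_P)

lemma Q_spanned: "Q = span (B \<inter> Q)"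
proof
  show "Q \<subseteq> span (B \<inter> Q)"
  proof
    fix v assume "v \<in> Q"
    then have "v \<in> span {b\<in>B. D b = (-1) *s b}"
      by (intro D_eigenspace_spanned) (simp add: Q_iff_D)
    moreover have "{b\<in>B. D b = (-1) *s b} = B \<inter> Q"
      by (auto simp: Q_iff_D)
    ultimately show "v \<in> span (B \<inter> Q)" by simp
  qed
qed (simp add: span_minimal subspace_Q)

lemma F_diagonal: "\<exists>c. \<forall>b\<in>B. F b = c b *s b"
proof -
  obtain c where c: "\<And>b. b \<in> B \<Longrightarrow> D b = c b *s b"
    using weight_basis_D by blast
  then have "\<forall>b\<in>B. F b = (c b * c b - 1) *s b"
    by (simp add: F_def D.scale scale_left_diff_distrib)
  then show ?thesis
    by (rule exI[of _ "\<lambda>b. c b * c b - 1"])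
qed

lemma F_F_eq_zero:
  assumes "F (F v) = 0"
  shows "F v = 0"
proof -
  obtain c where "\<And>b. b \<in> B \<Longrightarrow> F b = c b *s b"
    using F_diagonal by blast
  then show ?thesis
    using diagonal_kernel_Int_range[OF indep_B linear_F] assms span_B by auto
qed

lemma P_Q_F_decompose:
  obtains p q w where "v = p + q + F w" "p \<in> P" "q \<in> Q"
proof -
  obtain c where c: "\<And>b. b \<in> B \<Longrightarrow> F b = c b *s b"
    using F_diagonal by blast
  have v: "v \<in> span B"
    by (simp add: span_B)
  obtain x w where "v = x + F w" "F x = 0"
    by (rule diagonal_kernel_plus_range[OF indep_B linear_F c v])
  moreover obtain p q where "x = p + q" "p \<in> P" "q \<in> Q"
    using \<open>F x = 0\<close> by (rule F_kernel)
  ultimately show thesis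
    using that by simp
qed

text \<open>Applying \<open>F\<close> removes all terms but F (F w), so F w = 0 by
  diagonalizability; what remains is an element of both \<open>P\<close> and
  \<open>Q\<close>.\<close>

lemma P_Q_F_direct:
  assumes "p + q + F w = p' + q'" "p \<in> P" "q \<in> Q" "p' \<in> P" "q' \<in> Q"
  shows "p = p'" "q = q'" "F w = 0"
proof -
  have "F (F w) = F (p + q + F w)"
    using assms(2,3) by (simp add: F.add F_P F_Q)
  also have "\<dots> = 0"
    unfolding assms(1) using assms(4,5) by (simp add: F.add F_P F_Q)
  finally show Fw: "F w = 0"
    by (rule F_F_eq_zero)
  have "p - p' = q' - q"
    using assms(1) unfolding Fw by (simp add: algebra_simps)
  moreover have "p - p' \<in> P" "q' - q \<in> Q"
    using assms subspace_diff subspace_P subspace_Q by blast+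
  ultimately have "p - p' = 0" "q' - q = 0"
    using P_Int_Q[of "p - p'"] by simp_all
  then show "p = p'" "q = q'"
    by simp_all
qed

lemma weight_vectors_in_span:
  assumes "b \<in> B" "b \<in> X"
  shows "y1 b \<in> span X" "y2 b \<in> span X"
proof -
  obtain c1 c2 where "y1 b = c1 *s b" "y2 b = c2 *s b"
    using wb assms(1) unfolding weight_basis_def by blast
  then show "y1 b \<in> span X" "y2 b \<in> span X"
    using assms(2) by (simp_all add: span_scale span_base)
qed

lemma indecomposable_structure:
  assumes indec: "indecomposable" and e_nz: "e v0 \<noteq> 0"
  shows "F v = 0" and "p \<in> P \<Longrightarrow> s p = - p"
proof -
  obtain C where C: "C \<subseteq> B \<inter> P" "K \<inter> span C = {0}"
    and C_sum: "\<And>v. v \<in> P \<Longrightarrow> \<exists>x\<in>K. \<exists>y\<in>span C. v = x + y"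
    using exists_complement_spanned_by_subset[OF subspace_K, of "B \<inter> P"]
    unfolding P_spanned[symmetric] by blast
  obtain C' where C': "C' \<subseteq> B \<inter> Q" "L \<inter> span C' = {0}"
    and C'_sum: "\<And>v. v \<in> Q \<Longrightarrow> \<exists>x\<in>L. \<exists>y\<in>span C'. v = x + y"
    using exists_complement_spanned_by_subset[OF subspace_L, of "B \<inter> Q"]
    unfolding Q_spanned[symmetric] by blast
  \<comment> \<open>\<open>C\<close> and \<open>C'\<close> span the complements P' of
    \<open>K\<close> in \<open>P\<close> and Q' of \<open>L\<close> in \<open>Q\<close>. The spans
    of \<open>X\<close> and \<open>Y\<close> are the two candidate summands.\<close>
  define X where "X = C \<union> (L \<union> range F)"
  define Y where "Y = K \<union> C'"
  have "subrep (span X)"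
  proof (rule subrep_spanI)
    fix x assume "x \<in> X"
    then consider "x \<in> C" | "x \<in> L" | w where "x = F w"
      by (auto simp: X_def)
    then show "s x \<in> span X" "y1 x \<in> span X" "y2 x \<in> span X"
    proof (atomize(full), cases)
      case 1
      \<comment> \<open>Since \<open>x\<close> lies in \<open>P\<close>, s x + x lies in
        \<open>L\<close>, and s x is recovered by subtracting x.\<close>
      have "s x + x \<in> span X" "x \<in> span X"
        using 1 C(1) by (auto simp: X_def L_def intro!: span_base)
      then have "s x \<in> span X"
        using span_diff by fastforce
      then show "s x \<in> span X \<and> y1 x \<in> span X \<and> y2 x \<in> span X"
        using 1 C(1) \<open>x \<in> X\<close> weight_vectors_in_span by blast
    next
      case 2
      then have "s x \<in> X" "y1 x \<in> X" "y2 x \<in> X"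
        by (auto simp: s_L y_L X_def)
      then show "s x \<in> span X \<and> y1 x \<in> span X \<and> y2 x \<in> span X"
        by (simp add: span_base)
    next
      case 3
      then have "s x \<in> X" "y1 x \<in> X" "y2 x \<in> X"
        by (auto simp: X_def simp flip: F_s F_y1 F_y2)
      then show "s x \<in> span X \<and> y1 x \<in> span X \<and> y2 x \<in> span X"
        by (simp add: span_base)
    qed
  qed
  moreover have "subrep (span Y)"
  proof (rule subrep_spanI)
    fix y assume "y \<in> Y"
    then consider "y \<in> K" | "y \<in> C'"
      by (auto simp: Y_def)
    then show "s y \<in> span Y" "y1 y \<in> span Y" "y2 y \<in> span Y"
    proof (atomize(full), cases)
      case 1
      then have "s y \<in> span Y"
        using \<open>y \<in> Y\<close> by (simp add: K_def span_neg span_base)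
      moreover have "y1 y \<in> Y" "y2 y \<in> Y"
        using 1 by (simp_all add: y_K Y_def)
      ultimately show "s y \<in> span Y \<and> y1 y \<in> span Y \<and> y2 y \<in> span Y"
        by (simp add: span_base)
    next
      case 2
      \<comment> \<open>Since \<open>y\<close> lies in \<open>Q\<close>, s y - y lies in
        \<open>K\<close>.\<close>
      have "s y - y \<in> span Y" "y \<in> span Y"
        using 2 C'(1) s_Q_in_K by (auto simp: Y_def intro!: span_base)
      then have "s y \<in> span Y"
        using span_add by fastforce
      then show "s y \<in> span Y \<and> y1 y \<in> span Y \<and> y2 y \<in> span Y"
        using 2 C'(1) \<open>y \<in> Y\<close> weight_vectors_in_span by blast
    qed
  qed
  moreover have spanX: "\<exists>c\<in>span C. \<exists>l\<in>L. \<exists>w. u = c + l + F w" if "u \<in> span X" for u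
  proof -
    have "subspace (range F)"
      by (rule F.subspace_image[OF subspace_UNIV])
    then have closed: "span (range F) = range F" "span L = L"
      using subspace_L span_eq_iff by blast+
    show ?thesis
      using that unfolding X_def span_Un closed by (auto simp: add.assoc)
  qed
  have spanY: "\<exists>k\<in>K. \<exists>c\<in>span C'. u = k + c" if "u \<in> span Y" for u
  proof -
    have closed: "span K = K"
      using subspace_K span_eq_iff by blast
    show ?thesis
      using that unfolding Y_def span_Un closed by auto
  qed
  have CP: "span C \<subseteq> P" and CQ: "span C' \<subseteq> Q"
    using C(1) C'(1) subspace_P subspace_Q by (simp_all add: span_minimal)
  have "span X \<inter> span Y \<subseteq> {0}"
  proof
    fix u assume u: "u \<in> span X \<inter> span Y"
    obtain c l w where clw: "u = c + l + F w" "c \<in> span C" "l \<in> L"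
      using spanX u by blast
    obtain k c' where kc: "u = k + c'" "k \<in> K" "c' \<in> span C'"
      using spanY u by blast
    \<comment> \<open>Comparing components, the one in \<open>P\<close> lies in both
      \<open>K\<close> and \<open>span C\<close>, and the one in \<open>Q\<close> lies in both
      \<open>L\<close> and \<open>span C'\<close>; both therefore vanish.\<close>
    have "c \<in> P" "l \<in> Q" "k \<in> P" "c' \<in> Q"
      using clw(2,3) kc(2,3) CP CQ L_subset_Q unfolding K_def by blast+
    with clw(1)[unfolded kc(1), symmetric] have "c = k" "l = c'" "F w = 0"
      by (rule P_Q_F_direct)+
    moreover from this have "c = 0" "l = 0"
      using C(2) C'(2) clw(2,3) kc(2,3) by blast+
    ultimately show "u \<in> {0}"
      using clw(1) by simp
  qed
  then have "span X \<inter> span Y = {0}"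
    using span_zero by blast
  moreover have "\<exists>x\<in>span X. \<exists>y\<in>span Y. v = x + y" for v
  proof -
    obtain p q w where v: "v = p + q + F w" "p \<in> P" "q \<in> Q"
      by (rule P_Q_F_decompose)
    obtain k c where p: "p = k + c" "k \<in> K" "c \<in> span C"
      using C_sum v(2) by blast
    obtain l c' where q: "q = l + c'" "l \<in> L" "c' \<in> span C'"
      using C'_sum v(3) by blast
    have "c \<in> span X" "l \<in> span X" "F w \<in> span X"
      using p(3) q(2) span_mono[of C X] by (auto simp: X_def intro: span_base)
    then have "c + l + F w \<in> span X"
      by (intro span_add)
    moreover have "k \<in> span Y" "c' \<in> span Y"
      using q(3) p(2) span_mono[of C' Y] by (auto simp: Y_def intro: span_base)
    then have "k + c' \<in> span Y"
      by (intro span_add)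
    moreover have "v = (c + l + F w) + (k + c')"
      unfolding v(1) p(1) q(1) by (simp add: algebra_simps)
    ultimately show ?thesis by blast
  qed
  ultimately have "span X = {0} \<or> span Y = {0}"
    using indec unfolding indecomposable_def by blast
  moreover have "span Y \<noteq> {0}"
  proof
    assume "span Y = {0}"
    \<comment> \<open>\<open>e\<close> kills \<open>span C\<close> (contained in \<open>P\<close>),
      \<open>L\<close> and the range of \<open>F\<close>, so it would kill
      \<open>v0\<close>.\<close>
    then have "v0 \<in> span X"
      using \<open>\<And>v. \<exists>x\<in>span X. \<exists>y\<in>span Y. v = x + y\<close>[of v0] by auto
    then obtain c l w where "v0 = c + l + F w" "c \<in> span C" "l \<in> L"
      using spanX by blast
    then have "e v0 = 0"
      using CP by (auto simp: rho.add e_P e_L e_F)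
    with e_nz show False by contradiction
  qed
  ultimately have X0: "span X = {0}" by blast
  \<comment> \<open>Both conclusions are read off from generators of the vanishing summand: F v
    directly, and s p + p as an element of \<open>L\<close>.\<close>
  have "F v \<in> span X" for v
    by (rule span_base) (simp add: X_def)
  then show "F v = 0"
    using X0 by simp
  have "s p + p \<in> span X" if "p \<in> P"
    using that by (intro span_base) (simp add: X_def L_def)
  then show "s p = - p" if "p \<in> P"
    using X0 that by (simp add: eq_neg_iff_add_eq_0)
qed

end

section \<open>Matrices of operators\<close>

lemma has_matrix_mat_diag:
  assumes "\<And>j. j < length bs \<Longrightarrow> T (bs ! j) = c j *s bs ! j"
  shows "has_matrix bs T (mat_diag (length bs) c)"
  unfolding has_matrix_def
proof (intro conjI allI impI)
  fix j assume j: "j < length bs"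
  have "(\<Sum>i<length bs. mat_diag (length bs) c $$ (i, j) *s bs ! i)
      = (\<Sum>i<length bs. if i = j then c j *s bs ! j else 0)"
    using j by (intro sum.cong) (auto simp: mat_diag_def)
  then show "T (bs ! j) = (\<Sum>i<length bs. mat_diag (length bs) c $$ (i, j) *s bs ! i)"
    using j assms by simp
qed simp

lemma has_matrix_diagonalD:
  assumes "has_matrix bs T M" "diagonal_mat M" "j < length bs"
  shows "T (bs ! j) = M $$ (j, j) *s bs ! j"
proof -
  have "T (bs ! j) = (\<Sum>i<length bs. M $$ (i, j) *s bs ! i)"
    using assms by (simp add: has_matrix_def)
  also have "\<dots> = (\<Sum>i<length bs. if i = j then M $$ (j, j) *s bs ! j else 0)"
    using assms by (intro sum.cong) (auto simp: has_matrix_def diagonal_mat_def)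
  finally show ?thesis
    using assms(3) by simp
qed

lemma has_matrix_id: "has_matrix bs (\<lambda>v. v) (1\<^sub>m (length bs))"
  using has_matrix_mat_diag[of bs "\<lambda>v. v" "\<lambda>_. 1"] by (simp add: mat_diag_one)

lemma has_matrix_add:
  assumes "has_matrix bs T M" "has_matrix bs T' M'"
  shows "has_matrix bs (\<lambda>v. T v + T' v) (M + M')"
  using assms by (auto simp: has_matrix_def scale_left_distrib sum.distrib)

lemma has_matrix_uminus:
  assumes "has_matrix bs T M"
  shows "has_matrix bs (\<lambda>v. - T v) (- M)"
  using assms by (auto simp: has_matrix_def sum_negf)

lemma has_matrix_mult:
  assumes "Vector_Spaces.linear scale scale T" "has_matrix bs T M" "has_matrix bs T' M'"
  shows "has_matrix bs (\<lambda>v. T (T' v)) (M * M')"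
  unfolding has_matrix_def
proof (intro conjI allI impI)
  interpret T: Vector_Spaces.linear scale scale T by fact
  let ?n = "length bs"
  have M: "M \<in> carrier_mat ?n ?n" "M' \<in> carrier_mat ?n ?n"
    using assms by (auto simp: has_matrix_def)
  then show "M * M' \<in> carrier_mat ?n ?n" by simp
  fix j assume j: "j < ?n"
  have "T (T' (bs ! j)) = (\<Sum>k<?n. M' $$ (k, j) *s T (bs ! k))"
    using assms(3) j by (simp add: has_matrix_def T.sum T.scale)
  also have "\<dots> = (\<Sum>k<?n. \<Sum>i<?n. (M $$ (i, k) * M' $$ (k, j)) *s bs ! i)"
    using assms(2) by (intro sum.cong) (auto simp: has_matrix_def scale_sum_right mult.commute)
  also have "\<dots> = (\<Sum>i<?n. \<Sum>k<?n. (M $$ (i, k) * M' $$ (k, j)) *s bs ! i)"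
    by (rule sum.swap)
  also have "\<dots> = (\<Sum>i<?n. (M * M') $$ (i, j) *s bs ! i)"
    using M j by (intro sum.cong) (auto simp: scalar_prod_def lessThan_atLeast0 scale_sum_left)
  finally show "T (T' (bs ! j)) = (\<Sum>i<?n. (M * M') $$ (i, j) *s bs ! i)" .
qed

lemma calibrated_weight_basis:
  assumes "calibrated"
  obtains bs where "distinct bs" "weight_basis (set bs)"
proof -
  obtain bs D1 D2 where bs: "ordered_basis bs" "diagonal_mat D1" "diagonal_mat D2"
    "has_matrix bs y1 D1" "has_matrix bs y2 D2"
    using assms by (auto simp: calibrated_def)
  have "(\<exists>c. y1 b = c *s b) \<and> (\<exists>c. y2 b = c *s b)" if "b \<in> set bs" for b
    using that bs(2-5) has_matrix_diagonalD by (metis in_set_conv_nth)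
  then show thesis
    using that bs(1) unfolding weight_basis_def ordered_basis_def by blast
qed

lemma has_matrix_V_s:
  assumes S: "S \<in> carrier_mat (length ps) (length qs)"
    and "\<And>p. p \<in> set ps \<Longrightarrow> T p = - p"
    and "\<And>j. j < length qs \<Longrightarrow> T (qs ! j) = (\<Sum>i<length ps. S $$ (i, j) *s ps ! i) + qs ! j"
  shows "has_matrix (ps @ qs) T (V_s (length ps) (length qs) S)"
  unfolding has_matrix_def
proof (intro conjI allI impI)
  let ?k = "length ps" and ?l = "length qs"
  show "V_s ?k ?l S \<in> carrier_mat (length (ps @ qs)) (length (ps @ qs))"
    by (simp add: V_s_def)
  fix j assume j: "j < length (ps @ qs)"
  have "(\<Sum>i<length (ps @ qs). V_s ?k ?l S $$ (i, j) *s (ps @ qs) ! i)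
      = (\<Sum>i<?k. V_s ?k ?l S $$ (i, j) *s ps ! i)
      + (\<Sum>i<?l. V_s ?k ?l S $$ (?k + i, j) *s qs ! i)"
    by (simp add: sum_lessThan_add nth_append)
  also have "\<dots> = T ((ps @ qs) ! j)"
  proof (cases "j < ?k")
    case True
    have "(\<Sum>i<?k. V_s ?k ?l S $$ (i, j) *s ps ! i) = (\<Sum>i<?k. if i = j then - (ps ! j) else 0)"
      using True j S by (intro sum.cong) (auto simp: V_s_def)
    moreover have "(\<Sum>i<?l. V_s ?k ?l S $$ (?k + i, j) *s qs ! i) = 0"
      using True j S by (intro sum.neutral) (auto simp: V_s_def)
    ultimately show ?thesis
      using True assms(2) by (simp add: nth_append)
  next
    case False
    define m where "m = j - ?k"
    have m: "j = ?k + m" "m < ?l"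
      using False j by (auto simp: m_def)
    have "(\<Sum>i<?k. V_s ?k ?l S $$ (i, j) *s ps ! i) = (\<Sum>i<?k. S $$ (i, m) *s ps ! i)"
      using m S by (intro sum.cong) (auto simp: V_s_def)
    moreover have "(\<Sum>i<?l. V_s ?k ?l S $$ (?k + i, j) *s qs ! i)
        = (\<Sum>i<?l. if i = m then qs ! m else 0)"
      using m S by (intro sum.cong) (auto simp: V_s_def)
    ultimately show ?thesis
      using m assms(3) by simp
  qed
  finally show "T ((ps @ qs) ! j)
      = (\<Sum>i<length (ps @ qs). V_s ?k ?l S $$ (i, j) *s (ps @ qs) ! i)" ..
qed

text \<open>The weight basis is reordered with its members in \<open>P\<close> first and those in
  \<open>Q\<close> second. \<open>S\<close> records s - 1 from \<open>Q\<close> to \<open>P\<close>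
  in these coordinates.\<close>

lemma iso_to_V_exists:
  assumes "indecomposable" "calibrated" and e_nz: "e v0 \<noteq> 0"
  shows "\<exists>k l S a b. k \<ge> 1 \<and> l \<ge> 1 \<and> S \<in> carrier_mat k l \<and>
    a \<in> carrier_vec k \<and> b \<in> carrier_vec l \<and> iso_to_V k l S a b"
proof -
  obtain bs where "distinct bs" and wb: "weight_basis (set bs)"
    using assms(2) by (rule calibrated_weight_basis)
  note F0 = indecomposable_structure(1)[OF wb assms(1) e_nz]
  note sP = indecomposable_structure(2)[OF wb assms(1) e_nz]
  define ps where "ps = filter (\<lambda>b. b \<in> P) bs"
  define qs where "qs = filter (\<lambda>b. b \<in> Q) bs"
  have P: "P = span (set ps)" and Q: "Q = span (set qs)"
    using P_spanned[OF wb] Q_spanned[OF wb]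
    by (simp_all add: ps_def qs_def Int_def)
  have dec: "\<exists>p q. v = p + q \<and> p \<in> P \<and> q \<in> Q" for v
    using F_kernel[OF F0] by metis
  \<comment> \<open>Weights of \<open>y1\<close> and \<open>y2\<close>, meaningful only on
    \<open>bs\<close>. The other weight is \<alpha> - 1 on \<open>P\<close> and \<beta> - 1 on
    \<open>Q\<close>, so \<alpha> on \<open>ps\<close> supplies \<open>a\<close> and \<beta> on
    \<open>qs\<close> supplies \<open>b\<close>.\<close>
  define \<alpha> where "\<alpha> b = (SOME c. y1 b = c *s b)" for b
  define \<beta> where "\<beta> b = (SOME c. y2 b = c *s b)" for b
  have weights: "y1 b = \<alpha> b *s b" "y2 b = \<beta> b *s b" if "b \<in> set bs" for b
    unfolding \<alpha>_def \<beta>_def weight_basis_def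
    using that wb someI_ex[of "\<lambda>c. y1 b = c *s b"] someI_ex[of "\<lambda>c. y2 b = c *s b"]
    by (simp_all add: weight_basis_def)
  have y_ps: "y1 b = \<alpha> b *s b" "y2 b = (\<alpha> b - 1) *s b" if "b \<in> set ps" for b
    using that weights[of b] by (auto simp: ps_def P_def scale_left_diff_distrib eq_diff_eq)
  have y_qs: "y1 b = (\<beta> b - 1) *s b" "y2 b = \<beta> b *s b" if "b \<in> set qs" for b
    using that weights[of b] by (auto simp: qs_def Q_def scale_left_diff_distrib eq_diff_eq)
  have nz: "b \<noteq> 0" if "b \<in> set bs" for b
    using wb that dependent_zero by (auto simp: weight_basis_def)
  \<comment> \<open>The equation F b = 0 reads (\<alpha> b - \<beta> b)^2 = 1, as b is
    nonzero.\<close>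
  have bs_PQ: "b \<in> P \<or> b \<in> Q" if b: "b \<in> set bs" for b
  proof -
    have D: "D b = (\<alpha> b - \<beta> b) *s b"
      using weights[OF b] by (simp add: D_def scale_left_diff_distrib)
    have "D (D b) = ((\<alpha> b - \<beta> b) * (\<alpha> b - \<beta> b)) *s b"
      by (simp only: D D.scale scale_scale)
    then have "F b = ((\<alpha> b - \<beta> b) * (\<alpha> b - \<beta> b) - 1) *s b"
      by (simp add: F_def scale_left_diff_distrib)
    then have "\<alpha> b - \<beta> b = 1 \<or> \<alpha> b - \<beta> b = - 1"
      using F0[of b] nz[OF b] by (simp add: square_eq_1_iff)
    then have "\<alpha> b = \<beta> b + 1 \<or> \<beta> b = \<alpha> b + 1"
      by (auto simp: diff_eq_eq)
    then show ?thesis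
      using weights[OF b] by (auto simp: P_def Q_def scale_left_distrib)
  qed
  define k l where "k = length ps" and "l = length qs"
  have len: "length (ps @ qs) = k + l"
    by (simp add: k_def l_def)
  have set_eq: "set (ps @ qs) = set bs"
    using bs_PQ by (auto simp: ps_def qs_def)
  have "set ps \<inter> set qs = {}"
    using P_Int_Q nz by (auto simp: ps_def qs_def)
  then have "distinct (ps @ qs)"
    using \<open>distinct bs\<close> by (simp add: ps_def qs_def)
  then have basis: "ordered_basis (ps @ qs)"
    using wb unfolding ordered_basis_def set_eq by (simp add: weight_basis_def)
  \<comment> \<open>These coordinates become column \<open>j\<close> of \<open>S\<close>.\<close>
  have "\<exists>c. s (qs ! j) - qs ! j = (\<Sum>i<k. c i *s ps ! i)" if "j < l" for j
  proof -
    have "qs ! j \<in> Q"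
      using that nth_mem[of j qs] by (auto simp: l_def qs_def)
    then have "s (qs ! j) - qs ! j \<in> span (set ps)"
      using s_Q_in_P P by simp
    then show ?thesis
      unfolding k_def using \<open>distinct (ps @ qs)\<close> by (intro span_set_nth) auto
  qed
  then obtain c where c: "\<And>j. j < l \<Longrightarrow> s (qs ! j) - qs ! j = (\<Sum>i<k. c j i *s ps ! i)"
    by metis
  define S where "S = mat k l (\<lambda>(i, j). c j i)"
  define a where "a = vec k (\<lambda>i. \<alpha> (ps ! i))"
  define b where "b = vec l (\<lambda>j. \<beta> (qs ! j))"
  have ms: "has_matrix (ps @ qs) s (V_s k l S)"
    unfolding k_def l_def
  proof (rule has_matrix_V_s)
    show "S \<in> carrier_mat (length ps) (length qs)"
      by (simp add: S_def k_def l_def)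
    show "s p = - p" if "p \<in> set ps" for p
      using that sP by (auto simp: ps_def)
    show "s (qs ! j) = (\<Sum>i<length ps. S $$ (i, j) *s ps ! i) + qs ! j" if "j < length qs" for j
      using that c[of j] by (simp add: S_def k_def l_def diff_eq_eq)
  qed
  have my1: "has_matrix (ps @ qs) y1 (V_y1 k l a b)"
    unfolding V_y1_def len[symmetric]
    by (rule has_matrix_mat_diag)
      (auto simp: nth_append a_def b_def k_def l_def y_ps y_qs)
  have my2: "has_matrix (ps @ qs) y2 (V_y2 k l a b)"
    unfolding V_y2_def len[symmetric]
    by (rule has_matrix_mat_diag)
      (auto simp: nth_append a_def b_def k_def l_def y_ps y_qs)
  have "has_matrix (ps @ qs) (\<lambda>v. - s (y2 v) + y1 (s v) + v) (V_mat k l S a b Ge)"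
    unfolding V_mat.simps len[symmetric]
    by (intro has_matrix_add has_matrix_uminus has_matrix_mult has_matrix_id rho_linear ms my1 my2)
  then have me: "has_matrix (ps @ qs) e (V_mat k l S a b Ge)"
    by (simp add: e_eq[abs_def])
  have "has_matrix (ps @ qs) (\<rho> (pb_gen g)) (V_mat k l S a b g)" for g
    using ms my1 my2 me by (cases g) auto
  then have "iso_to_V k l S a b"
    using basis len unfolding iso_to_V_def by blast
  \<comment> \<open>\<open>e v0\<close> is a nonzero element of \<open>P\<close>.\<close>
  moreover have "k \<noteq> 0"
    using e_in_P[of v0] e_nz P by (auto simp: k_def)
  \<comment> \<open>Otherwise the whole space would be \<open>P\<close>, which \<open>e\<close>
    kills.\<close>
  moreover have "l \<noteq> 0"
  proof
    assume "l = 0"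
    then have "Q = {0}"
      using Q by (simp add: l_def)
    then have "v0 \<in> P"
      using dec[of v0] by auto
    then show False
      using e_nz e_P by blast
  qed
  moreover have "S \<in> carrier_mat k l" "a \<in> carrier_vec k" "b \<in> carrier_vec l"
    by (simp_all add: S_def a_def b_def)
  ultimately show ?thesis
    by (metis One_nat_def Suc_leI neq0_conv)
qed

end

theorem theorem11:
  fixes scale :: "complex \<Rightarrow> 'v::ab_group_add \<Rightarrow> 'v"
    and \<rho> :: "pbrauer \<Rightarrow> 'v \<Rightarrow> 'v"
  assumes "pbrauer_rep scale \<rho>"
    and "pbrauer_rep.finite_dim scale"
    and "pbrauer_rep.indecomposable scale \<rho>"
    and "pbrauer_rep.calibrated scale \<rho>"
    and "\<exists>v. \<rho> (pb_gen Ge) v \<noteq> 0"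
  shows "\<exists>k l S a b. k \<ge> 1 \<and> l \<ge> 1 \<and> S \<in> carrier_mat k l \<and>
    a \<in> carrier_vec k \<and> b \<in> carrier_vec l \<and> pbrauer_rep.iso_to_V scale \<rho> k l S a b"
  using pbrauer_rep.iso_to_V_exists[OF assms(1,3,4)] assms(5) by blast

end
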